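(* Let $\mathcal H$ be a real Hilbert space and let $\Phi:\mathcal H\to\mathbb R$ be a continuously differentiable convex function which is uniformly convex on bounded sets and satisfies $\operatorname{argmin}\Phi\neq\emptyset$. Let $t_0>0$, $\alpha>3$, and let $x:[t_0,+\infty[\to\mathcal H$ be a solution of $$\ddot x(t)+\frac{\alpha}{t}\dot x(t)+\nabla\Phi(x(t))=0 .$$ Then $x(t)$ converges strongly, as $t\to+\infty$, to the unique $x^*\in\operatorname{argmin}\Phi$.
   Context: A function $\Phi:\mathcal H\to\mathbb R$ (differentiable) is uniformly convex on bounded sets if, for each $r>0$, there is an increasing function $\omega_r:[0,+\infty[\to[0,+\infty[$ vanishing only at $0$ such that $$\Phi(y)\ge\Phi(x)+\langle\nabla\Phi(x),y-x\rangle+\omega_r(\|x-y\|)$$ for all $x,y\in\mathcal H$ with $\|x\|\le r$ and $\|y\|\le r$. A solution on $[t_0,+\infty[$ is a twice continuously differentiable function $x:[t_0,+\infty[\to\mathcal H$ satisfying the equation for all $t\ge t_0$. $\operatorname{argmin}\Phi$ denotes the set of global minimizers of $\Phi$. Strong convergence means convergence in norm. *)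

theory Defs
  imports "HOL-Analysis.Analysis"
begin

text \<open>A real Hilbert space is a type of sort \<open>{real_inner, complete_space}\<close>.\<close>

text \<open>
  The gradient is the Riesz representative of the Frechet derivative; it exists at every
  point of differentiability of a function on a Hilbert space, see \<open>GDERIV_gradient\<close> below.
\<close>
definition gradient :: "('a::real_inner \<Rightarrow> real) \<Rightarrow> 'a \<Rightarrow> 'a" where
  "gradient \<Phi> z = (THE D. GDERIV \<Phi> z :> D)"

text \<open>Continuity of the derivative is with respect to the operator norm on the dual.\<close>
definition continuously_differentiable :: "('a::real_normed_vector \<Rightarrow> real) \<Rightarrow> bool" where
  "continuously_differentiable \<Phi> \<longleftrightarrow>
    (\<exists>\<Phi>' :: 'a \<Rightarrow> 'a \<Rightarrow>\<^sub>L real.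
       (\<forall>z. (\<Phi> has_derivative blinfun_apply (\<Phi>' z)) (at z)) \<and> continuous_on UNIV \<Phi>')"

text \<open>
  The modulus \<open>\<omega>\<close> is increasing in the non-strict sense, and only its values
  on the half-line \<open>{0..}\<close> matter.
\<close>
definition uniformly_convex_on_bounded_sets :: "('a::real_inner \<Rightarrow> real) \<Rightarrow> bool" where
  "uniformly_convex_on_bounded_sets \<Phi> \<longleftrightarrow>
    (\<forall>r>0. \<exists>\<omega> :: real \<Rightarrow> real.
       \<omega> \<in> {0..} \<rightarrow> {0..} \<and> mono_on {0..} \<omega> \<and> (\<forall>s\<ge>0. \<omega> s = 0 \<longleftrightarrow> s = 0) \<and>
       (\<forall>x y. norm x \<le> r \<longrightarrow> norm y \<le> r \<longrightarrow>
          \<Phi> y \<ge> \<Phi> x + gradient \<Phi> x \<bullet> (y - x) + \<omega> (norm (x - y))))"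

definition argmin :: "('a \<Rightarrow> real) \<Rightarrow> 'a set" where
  "argmin \<Phi> = {z. is_arg_min \<Phi> (\<lambda>_. True) z}"

text \<open>
  The trajectory lives on \<open>{t0..}\<close>: derivatives at \<open>t0\<close> are one-sided, and the values of
  the total function \<open>x\<close> to the left of \<open>t0\<close> are irrelevant.
\<close>
definition is_solution ::
  "real \<Rightarrow> ('a::real_inner \<Rightarrow> real) \<Rightarrow> real \<Rightarrow> (real \<Rightarrow> 'a) \<Rightarrow> bool" where
  "is_solution \<alpha> \<Phi> t0 x \<longleftrightarrow>
    (\<exists>x' x''.
       (\<forall>t\<ge>t0. (x has_vector_derivative x' t) (at t within {t0..})) \<and>
       (\<forall>t\<ge>t0. (x' has_vector_derivative x'' t) (at t within {t0..})) \<and>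
       continuous_on {t0..} x'' \<and>
       (\<forall>t\<ge>t0. x'' t + (\<alpha> / t) *\<^sub>R x' t + gradient \<Phi> (x t) = 0))"

lemma gradient_eqI:
  assumes "GDERIV \<Phi> z :> D"
  shows "gradient \<Phi> z = D"
  unfolding gradient_def
proof (rule the_equality)
  fix E assume "GDERIV \<Phi> z :> E"
  then have "(\<lambda>h. h \<bullet> E) = (\<lambda>h. h \<bullet> D)"
    using assms has_derivative_unique unfolding gderiv_def by blast
  then have "(E - D) \<bullet> (E - D) = 0"
    by (metis inner_diff_right right_minus_eq)
  then show "E = D" by simp
qed (rule assms)

lemma Riesz_representation:
  fixes f :: "'a::{real_inner, complete_space} \<Rightarrow> real"
  assumes "bounded_linear f"
  shows "\<exists>u. \<forall>h. f h = h \<bullet> u"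
proof -
  interpret bounded_linear f by fact
  define J where "J u = u \<bullet> u - 2 * f u" for u
  obtain K where K: "\<And>u. \<bar>f u\<bar> \<le> norm u * K"
    using bounded by auto
  have lower: "J u \<ge> - (K\<^sup>2)" for u
  proof -
    have "0 \<le> (norm u - K)\<^sup>2" by simp
    moreover have "f u \<le> norm u * K" using K[of u] by linarith
    ultimately show ?thesis
      unfolding J_def power2_norm_eq_inner[symmetric] by (simp add: power2_diff)
  qed
  define m where "m = (INF u. J u)"
  have bdd: "bdd_below (range J)" using lower by (auto intro!: bdd_belowI)
  have m_le: "m \<le> J u" for u
    unfolding m_def using bdd by (intro cINF_lower) auto
  have "\<exists>u. J u < m + e" if "e > 0" for e
    using cINF_less_iff[OF _ bdd, of "m + e"] that m_def by auto
  then have "\<exists>u. J u < m + inverse (real (Suc n))" for n by simp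
  then obtain U where U: "\<And>n. J (U n) < m + inverse (real (Suc n))" by metis
  have par: "(norm (u - v))\<^sup>2 \<le> 2 * (J u + J v - 2 * m)" for u v
  proof -
    define w where "w = (1/2) *\<^sub>R (u + v)"
    have "J u + J v - 2 * J w = (norm (u - v))\<^sup>2 / 2"
      unfolding J_def w_def power2_norm_eq_inner scaleR add
      by (simp add: inner_simps inner_commute field_simps)
    with m_le[of w] show ?thesis by (simp add: field_simps)
  qed
  have "Cauchy U"
    unfolding Cauchy_iff
  proof (intro allI impI)
    fix e :: real assume e: "e > 0"
    then obtain N where N: "inverse (real (Suc N)) < e\<^sup>2 / 4"
      using reals_Archimedean[of "e\<^sup>2 / 4"] by auto
    have small: "J (U n) < m + e\<^sup>2 / 4" if "n \<ge> N" for n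
    proof -
      have "inverse (real (Suc n)) \<le> inverse (real (Suc N))"
        using that by (intro le_imp_inverse_le) auto
      with U[of n] N show ?thesis by linarith
    qed
    show "\<exists>M. \<forall>k\<ge>M. \<forall>n\<ge>M. norm (U k - U n) < e"
    proof (intro exI allI impI)
      fix k n assume kn: "k \<ge> N" "n \<ge> N"
      then have "(norm (U k - U n))\<^sup>2 < e\<^sup>2"
        using par[of "U k" "U n"] small[OF kn(1)] small[OF kn(2)]
        by (simp add: field_simps)
      then show "norm (U k - U n) < e" using e by (simp add: power2_less_imp_less)
    qed
  qed
  then obtain u where u: "U \<longlonglongrightarrow> u"
    using Cauchy_convergent convergent_def by blast
  have "(\<lambda>n. J (U n)) \<longlonglongrightarrow> J u"
    unfolding J_def by (intro tendsto_intros tendsto u)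
  moreover have "(\<lambda>n. m + inverse (real (Suc n))) \<longlonglongrightarrow> m + 0"
    by (intro tendsto_intros LIMSEQ_inverse_real_of_nat)
  ultimately have "J u \<le> m"
    using U by (intro LIMSEQ_le[of _ "J u" _ m]) (auto intro: less_imp_le)
  then have min: "J u \<le> J v" for v using m_le[of v] by linarith
  have "f h = h \<bullet> u" for h
  proof (cases "h = 0")
    case False
    define c where "c = h \<bullet> u - f h"
    define s where "s = - c / (h \<bullet> h)"
    have hh: "h \<bullet> h > 0" using False by simp
    have "J (u + s *\<^sub>R h) - J u = 2 * s * c + s * s * (h \<bullet> h)"
      unfolding J_def c_def scaleR add by (simp add: inner_simps inner_commute algebra_simps)
    also have "\<dots> = - (c\<^sup>2 / (h \<bullet> h))"
      unfolding s_def using hh by (simp add: field_simps power2_eq_square)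
    finally have "c\<^sup>2 / (h \<bullet> h) \<le> 0" using min[of "u + s *\<^sub>R h"] by linarith
    then have "c\<^sup>2 \<le> 0" using hh by (simp add: divide_le_0_iff)
    then show ?thesis unfolding c_def by simp
  qed (simp add: zero)
  then show ?thesis by blast
qed

lemma GDERIV_gradient:
  fixes \<Phi> :: "'a::{real_inner, complete_space} \<Rightarrow> real"
  assumes "\<Phi> differentiable (at z)"
  shows "GDERIV \<Phi> z :> gradient \<Phi> z"
proof -
  obtain \<Phi>' where D: "(\<Phi> has_derivative \<Phi>') (at z)"
    using assms unfolding differentiable_def by blast
  then obtain u where "\<And>h. \<Phi>' h = h \<bullet> u"
    using Riesz_representation has_derivative_bounded_linear by metis
  then have "\<Phi>' = (\<lambda>h. h \<bullet> u)" by blast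
  with D have "GDERIV \<Phi> z :> u" unfolding gderiv_def by simp
  then show ?thesis using gradient_eqI by metis
qed

end

theory Submission
  imports Defs
begin

text \<open>
  For a minimizer \<open>z\<close> the Lyapunov function
  \<open>t\<^sup>2 (\<Phi> (x t) - \<Phi> z) + \<parallel>2 (x t - z) + t x' t\<parallel>\<^sup>2 / 2 + (\<alpha> - 3) \<parallel>x t - z\<parallel>\<^sup>2\<close>
  is nonincreasing along trajectories. Its last term shows that the trajectory is bounded, its first
  term that \<open>\<Phi> (x t)\<close> tends to the minimum. Uniform convexity on a ball containing the trajectory
  turns convergence of the values into strong convergence.
\<close>

lemma gradient_argmin_eq_0:
  fixes \<Phi> :: "'a::real_inner \<Rightarrow> real"
  assumes "GDERIV \<Phi> z :> D" and "z \<in> argmin \<Phi>"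
  shows "D = 0"
proof -
  have min: "\<Phi> z \<le> \<Phi> y" for y
    using assms(2) unfolding argmin_def is_arg_min_linorder by blast
  have "(\<lambda>h. h \<bullet> D) = (\<lambda>h. 0)"
    by (rule has_derivative_local_min[of \<Phi> _ z])
      (use assms(1) min in \<open>auto simp: gderiv_def\<close>)
  then have "D \<bullet> D = 0" by metis
  then show ?thesis by simp
qed

lemma uniformly_convex_modulusE:
  fixes \<Phi> :: "'a::real_inner \<Rightarrow> real"
  assumes "uniformly_convex_on_bounded_sets \<Phi>"
  obtains \<omega> :: "real \<Rightarrow> real" where
    "\<And>s. s \<ge> 0 \<Longrightarrow> \<omega> s \<ge> 0"
    "\<And>s u. 0 \<le> s \<Longrightarrow> s \<le> u \<Longrightarrow> \<omega> s \<le> \<omega> u"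
    "\<And>s. s > 0 \<Longrightarrow> \<omega> s > 0"
    "\<And>x y. norm x \<le> r \<Longrightarrow> norm y \<le> r \<Longrightarrow>
       \<Phi> y \<ge> \<Phi> x + gradient \<Phi> x \<bullet> (y - x) + \<omega> (norm (x - y))"
proof -
  \<comment> \<open>The definition supplies a modulus only for positive radii. The radius
    \<open>max r 1\<close> is admissible and its ball contains the ball of radius \<open>r\<close>,
    so \<open>r\<close> may be any real number.\<close>
  have "max r 1 > 0" by simp
  then obtain \<omega> :: "real \<Rightarrow> real" where
    \<omega>: "\<omega> \<in> {0..} \<rightarrow> {0..}" "mono_on {0..} \<omega>" "\<forall>s\<ge>0. \<omega> s = 0 \<longleftrightarrow> s = 0"
    "\<forall>x y. norm x \<le> max r 1 \<longrightarrow> norm y \<le> max r 1 \<longrightarrow>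
       \<Phi> y \<ge> \<Phi> x + gradient \<Phi> x \<bullet> (y - x) + \<omega> (norm (x - y))"
    using assms unfolding uniformly_convex_on_bounded_sets_def by blast
  have nonneg: "\<omega> s \<ge> 0" if "s \<ge> 0" for s
    using \<omega>(1) that by (auto simp: Pi_iff)
  show thesis
  proof (rule that)
    show "\<omega> s \<le> \<omega> u" if "0 \<le> s" "s \<le> u" for s u
      using \<omega>(2) that by (auto simp: mono_on_def)
    show "\<omega> s > 0" if "s > 0" for s
      using \<omega>(3) nonneg[of s] that by (simp add: less_le)
    show "\<Phi> y \<ge> \<Phi> x + gradient \<Phi> x \<bullet> (y - x) + \<omega> (norm (x - y))"
      if "norm x \<le> r" "norm y \<le> r" for x y
      using \<omega>(4) that by (simp add: le_max_iff_disj)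
  qed (rule nonneg)
qed

text \<open>The gradient vanishes at a minimizer, so the uniform convexity inequality based at
  \<open>z\<close> loses its linear term and leaves a gap of at least
  \<open>\<omega> (norm (y - z))\<close>. Monotonicity bounds this below by
  \<open>\<omega> e\<close>, which does not depend on \<open>y\<close>.\<close>

lemma uniformly_convex_argmin_growth:
  fixes \<Phi> :: "'a::real_inner \<Rightarrow> real"
  assumes diff: "\<And>u. GDERIV \<Phi> u :> gradient \<Phi> u"
    and uc: "uniformly_convex_on_bounded_sets \<Phi>"
    and z: "z \<in> argmin \<Phi>"
    and "e > 0"
  obtains \<delta> where "\<delta> > 0" "\<And>y. norm y \<le> r \<Longrightarrow> e \<le> norm (y - z) \<Longrightarrow> \<Phi> z + \<delta> \<le> \<Phi> y"
proof -
  \<comment> \<open>The radius \<open>max r (norm z)\<close> keeps the base point \<open>z\<close>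
    inside the ball even when \<open>norm z\<close> exceeds \<open>r\<close>.\<close>
  obtain \<omega> :: "real \<Rightarrow> real" where
    \<omega>: "\<And>s u. 0 \<le> s \<Longrightarrow> s \<le> u \<Longrightarrow> \<omega> s \<le> \<omega> u" "\<And>s. s > 0 \<Longrightarrow> \<omega> s > 0"
    "\<And>x y. norm x \<le> max r (norm z) \<Longrightarrow> norm y \<le> max r (norm z) \<Longrightarrow>
       \<Phi> y \<ge> \<Phi> x + gradient \<Phi> x \<bullet> (y - x) + \<omega> (norm (x - y))"
    using uniformly_convex_modulusE[OF uc] by metis
  have g0: "gradient \<Phi> z = 0"
    using gradient_argmin_eq_0[OF diff z] .
  show thesis
  proof (rule that)
    show "\<omega> e > 0" using \<omega>(2) \<open>e > 0\<close> .
    show "\<Phi> z + \<omega> e \<le> \<Phi> y" if "norm y \<le> r" "e \<le> norm (y - z)" for y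
      using \<omega>(1)[of e "norm (y - z)"] \<omega>(3)[of z y] that \<open>e > 0\<close>
      by (simp add: g0 norm_minus_commute le_max_iff_disj)
  qed
qed

text \<open>By the growth bound with \<open>e\<close> equal to \<open>norm (y - z)\<close> and
  radius \<open>norm y\<close>, a second minimizer \<open>y\<close> would have a value strictly
  above the minimum.\<close>

lemma uniformly_convex_argmin_unique:
  fixes \<Phi> :: "'a::real_inner \<Rightarrow> real"
  assumes "\<And>u. GDERIV \<Phi> u :> gradient \<Phi> u"
    and "uniformly_convex_on_bounded_sets \<Phi>"
    and "z \<in> argmin \<Phi>"
  shows "argmin \<Phi> = {z}"
proof -
  have "y = z" if y: "y \<in> argmin \<Phi>" for y
  proof (rule ccontr)
    assume "y \<noteq> z"
    then have "norm (y - z) > 0" by simp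
    then obtain \<delta> where "\<delta> > 0" "\<Phi> z + \<delta> \<le> \<Phi> y"
      using uniformly_convex_argmin_growth[OF assms] by (metis order_refl)
    moreover have "\<Phi> y \<le> \<Phi> z"
      using y unfolding argmin_def is_arg_min_linorder by blast
    ultimately show False by simp
  qed
  with assms(3) show ?thesis by blast
qed

text \<open>The weight 2 in \<open>w\<close> makes the inner product of \<open>w\<close> with its
  derivative contribute -2t times the pairing of the gradient with \<open>x t - z\<close>. Together
  with the 2t coming from the derivative of \<open>t\<^sup>2\<close>, this is nonpositive by
  \<open>conv\<close>. What remains is the dissipation of the damping in excess of 3.\<close>

lemma lyapunov_nonincreasing:
  fixes \<Phi> :: "'a::real_inner \<Rightarrow> real" and x x' x'' :: "real \<Rightarrow> 'a"
  assumes diff: "\<And>u. GDERIV \<Phi> u :> gradient \<Phi> u"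
    and conv: "\<And>u. \<Phi> u - \<Phi> z \<le> gradient \<Phi> u \<bullet> (u - z)"
    and x: "\<And>t. t \<ge> t0 \<Longrightarrow> (x has_vector_derivative x' t) (at t within {t0..})"
    and x': "\<And>t. t \<ge> t0 \<Longrightarrow> (x' has_vector_derivative x'' t) (at t within {t0..})"
    and ode: "\<And>t. t \<ge> t0 \<Longrightarrow> x'' t + (\<alpha> / t) *\<^sub>R x' t + gradient \<Phi> (x t) = 0"
    and "t0 > 0" "\<alpha> \<ge> 3" "t0 \<le> t"
  defines "w \<equiv> \<lambda>t. 2 *\<^sub>R (x t - z) + t *\<^sub>R x' t"
  defines "E \<equiv> \<lambda>t. t\<^sup>2 * (\<Phi> (x t) - \<Phi> z) + (w t \<bullet> w t) / 2 + (\<alpha> - 3) * ((x t - z) \<bullet> (x t - z))"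
  shows "E t \<le> E t0"
proof -
  \<comment> \<open>The derivative of \<open>E\<close> after \<open>x''\<close> has been eliminated
    through the differential equation.\<close>
  define D where "D t = 2 * t * (\<Phi> (x t) - \<Phi> z) - 2 * t * (gradient \<Phi> (x t) \<bullet> (x t - z))
      - (\<alpha> - 3) * t * (x' t \<bullet> x' t)" for t
  have deriv: "(E has_real_derivative D t) (at t within {t0..})" if t: "t \<ge> t0" for t
  proof -
    have xd: "(x has_derivative (\<lambda>h. h *\<^sub>R x' t)) (at t within {t0..})"
      and x'd: "(x' has_derivative (\<lambda>h. h *\<^sub>R x'' t)) (at t within {t0..})"
      using x[OF t] x'[OF t] by (simp_all add: has_vector_derivative_def)
    have "(\<Phi> has_derivative (\<lambda>h. h \<bullet> gradient \<Phi> (x t))) (at (x t))"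
      using diff by (simp add: gderiv_def)
    from diff_chain_within[OF xd has_derivative_at_withinI[OF this]]
    have \<Phi>d: "((\<lambda>t. \<Phi> (x t)) has_derivative (\<lambda>h. (h *\<^sub>R x' t) \<bullet> gradient \<Phi> (x t))) (at t within {t0..})"
      by (simp add: o_def)
    have "t > 0" using t \<open>t0 > 0\<close> by simp
    have "x'' t = - ((\<alpha> / t) *\<^sub>R x' t + gradient \<Phi> (x t))"
      using ode[OF t] unfolding eq_neg_iff_add_eq_0 add.assoc .
    then have x''_eq: "x'' t = - (\<alpha> / t) *\<^sub>R x' t - gradient \<Phi> (x t)"
      by simp
    define G where "G = gradient \<Phi> (x t)"
    define w' where "w' = 2 *\<^sub>R x' t + (x' t + t *\<^sub>R x'' t)"
    have vd: "((\<lambda>t. x t - z) has_derivative (\<lambda>h. h *\<^sub>R x' t)) (at t within {t0..})"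
      using has_derivative_diff[OF xd has_derivative_const[of z]] by simp
    have wd: "(w has_derivative (\<lambda>h. h *\<^sub>R w')) (at t within {t0..})"
      unfolding w_def w'_def
      by (rule derivative_eq_intros vd x'd refl)+ (simp add: fun_eq_iff algebra_simps)
    have inner_self: "((\<lambda>t. f t \<bullet> f t) has_real_derivative 2 * (f t \<bullet> f')) (at t within {t0..})"
      if "(f has_derivative (\<lambda>h. h *\<^sub>R f')) (at t within {t0..})" for f :: "real \<Rightarrow> 'a" and f'
      unfolding has_field_derivative_def
      by (rule has_derivative_eq_rhs[OF has_derivative_inner[OF that that]])
        (simp add: fun_eq_iff inner_commute)
    have \<Phi>d': "((\<lambda>t. \<Phi> (x t)) has_real_derivative x' t \<bullet> G) (at t within {t0..})"
      unfolding has_field_derivative_def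
      by (rule has_derivative_eq_rhs[OF \<Phi>d]) (simp add: fun_eq_iff G_def)
    have "(E has_real_derivative 2 * t * (\<Phi> (x t) - \<Phi> z) + t\<^sup>2 * (x' t \<bullet> G)
        + w t \<bullet> w' + 2 * (\<alpha> - 3) * ((x t - z) \<bullet> x' t)) (at t within {t0..})"
      unfolding E_def
      by (rule derivative_eq_intros inner_self wd vd \<Phi>d' refl zero_neq_numeral[symmetric])+ simp
    moreover have w'_eq: "w' = (3 - \<alpha>) *\<^sub>R x' t - t *\<^sub>R G"
    proof -
      have "t *\<^sub>R x'' t = - \<alpha> *\<^sub>R x' t - t *\<^sub>R G"
        using \<open>t > 0\<close> unfolding x''_eq G_def by (simp add: scaleR_diff_right)
      then have "w' = 2 *\<^sub>R x' t + (1 *\<^sub>R x' t + (- \<alpha> *\<^sub>R x' t - t *\<^sub>R G))"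
        by (simp add: w'_def)
      also have "\<dots> = (2 + 1 + - \<alpha>) *\<^sub>R x' t - t *\<^sub>R G"
        unfolding scaleR_add_left by simp
      finally show ?thesis by simp
    qed
    \<comment> \<open>Two cross terms cancel: \<open>t\<^sup>2 * (x' t \<bullet> G)\<close> against
      the product of \<open>t *\<^sub>R x' t\<close> and \<open>- t *\<^sub>R G\<close>, and the
      derivative of the last term of \<open>E\<close> against the product of
      \<open>2 *\<^sub>R (x t - z)\<close> and \<open>(3 - \<alpha>) *\<^sub>R x' t\<close>.\<close>
    have "2 * t * (\<Phi> (x t) - \<Phi> z) + t\<^sup>2 * (x' t \<bullet> G) + w t \<bullet> w'
        + 2 * (\<alpha> - 3) * ((x t - z) \<bullet> x' t) = D t"
    proof -
      \<comment> \<open>Naming the difference keeps it atomic when inner products are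
        expanded.\<close>
      define v where "v = x t - z"
      show ?thesis
        unfolding w'_eq w_def D_def G_def[symmetric] v_def[symmetric]
        by (simp add: inner_add_left inner_diff_right inner_commute
            power2_eq_square algebra_simps)
    qed
    ultimately show ?thesis by simp
  qed
  have D_nonpos: "D t \<le> 0" if "t \<ge> t0" for t
  proof -
    have "2 * t * (\<Phi> (x t) - \<Phi> z) \<le> 2 * t * (gradient \<Phi> (x t) \<bullet> (x t - z))"
      using that \<open>t0 > 0\<close> conv by (intro mult_left_mono) auto
    moreover have "(\<alpha> - 3) * t * (x' t \<bullet> x' t) \<ge> 0"
      using that \<open>t0 > 0\<close> \<open>\<alpha> \<ge> 3\<close> by simp
    ultimately show ?thesis unfolding D_def by simp
  qed
  show ?thesis
  \<comment> \<open>The derivative at \<open>t0\<close> is only one-sided. The open-interval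
    criterion asks for two-sided derivatives strictly inside and mere continuity at the
    endpoints.\<close>
  proof (rule DERIV_nonpos_imp_decreasing_open[OF \<open>t0 \<le> t\<close>])
    show "\<exists>y. (E has_real_derivative y) (at s) \<and> y \<le> 0" if "t0 < s" "s < t" for s
      using deriv[of s] D_nonpos[of s] that at_within_interior[of s "{t0..}"] by auto
    have "continuous_on {t0..} E"
      using deriv by (intro DERIV_continuous_on) auto
    then show "continuous_on {t0..t} E"
      by (rule continuous_on_subset) auto
  qed
qed

theorem theorem3p3:
  fixes \<Phi> :: "'a::{real_inner, complete_space} \<Rightarrow> real"
    and x :: "real \<Rightarrow> 'a"
    and t0 \<alpha> :: real
  assumes "continuously_differentiable \<Phi>"
    and "convex_on UNIV \<Phi>"
    and "uniformly_convex_on_bounded_sets \<Phi>"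
    and "argmin \<Phi> \<noteq> {}"
    and "t0 > 0"
    and "\<alpha> > 3"
    and "is_solution \<alpha> \<Phi> t0 x"
  shows "\<exists>xs. argmin \<Phi> = {xs} \<and> (x \<longlongrightarrow> xs) at_top"
proof -
  have diff: "GDERIV \<Phi> u :> gradient \<Phi> u" for u
    using assms(1) unfolding continuously_differentiable_def
    by (intro GDERIV_gradient) (auto simp: differentiable_def)
  obtain z where z: "z \<in> argmin \<Phi>" using assms(4) by blast
  have min: "\<Phi> z \<le> \<Phi> y" for y
    using z unfolding argmin_def is_arg_min_linorder by blast
  \<comment> \<open>This is the uniform convexity inequality based at \<open>u\<close> and tested at
    \<open>z\<close>, with the nonnegative modulus dropped; the radius is chosen so that the ball
    contains both points.\<close>
  have conv: "\<Phi> u - \<Phi> z \<le> gradient \<Phi> u \<bullet> (u - z)" for u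
  proof -
    obtain \<omega> :: "real \<Rightarrow> real" where "\<And>s. s \<ge> 0 \<Longrightarrow> \<omega> s \<ge> 0"
      "\<And>a b. norm a \<le> max (norm u) (norm z) \<Longrightarrow> norm b \<le> max (norm u) (norm z) \<Longrightarrow>
         \<Phi> b \<ge> \<Phi> a + gradient \<Phi> a \<bullet> (b - a) + \<omega> (norm (a - b))"
      using uniformly_convex_modulusE[OF assms(3)] by metis
    from this(1)[of "norm (u - z)"] this(2)[of u z] show ?thesis
      by (simp add: inner_diff_right)
  qed
  obtain x' x'' where
    x: "\<And>t. t \<ge> t0 \<Longrightarrow> (x has_vector_derivative x' t) (at t within {t0..})"
    and x': "\<And>t. t \<ge> t0 \<Longrightarrow> (x' has_vector_derivative x'' t) (at t within {t0..})"
    and ode: "\<And>t. t \<ge> t0 \<Longrightarrow> x'' t + (\<alpha> / t) *\<^sub>R x' t + gradient \<Phi> (x t) = 0"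
    using assms(7) unfolding is_solution_def by blast
  \<comment> \<open>The constant is the initial value \<open>E t0\<close>. All three summands of
    \<open>E\<close> are nonnegative, because \<open>z\<close> is a minimizer and \<alpha> > 3, so
    the first and the last are each at most \<open>E t\<close>.\<close>
  obtain C where C: "t\<^sup>2 * (\<Phi> (x t) - \<Phi> z) \<le> C" "(\<alpha> - 3) * (norm (x t - z))\<^sup>2 \<le> C" if "t \<ge> t0" for t
  proof -
    define w where "w t = 2 *\<^sub>R (x t - z) + t *\<^sub>R x' t" for t
    define E where "E t = t\<^sup>2 * (\<Phi> (x t) - \<Phi> z) + (w t \<bullet> w t) / 2
      + (\<alpha> - 3) * ((x t - z) \<bullet> (x t - z))" for t
    have "E t \<le> E t0" if "t \<ge> t0" for t
      unfolding E_def w_def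
      using lyapunov_nonincreasing[OF diff conv x x' ode assms(5) _ that] assms(6) by simp
    moreover have "t\<^sup>2 * (\<Phi> (x t) - \<Phi> z) \<le> E t" "(\<alpha> - 3) * (norm (x t - z))\<^sup>2 \<le> E t" for t
      using min[of "x t"] assms(6) by (simp_all add: E_def power2_norm_eq_inner)
    ultimately show thesis
      by (intro that[of "E t0"]) (blast intro: order_trans)+
  qed
  \<comment> \<open>Strictness of \<alpha> > 3 permits the division. The radius is independent of
    \<open>t\<close>, so one gap \<delta> serves the whole trajectory below.\<close>
  have bounded: "norm (x t) \<le> norm z + sqrt (C / (\<alpha> - 3))" if "t \<ge> t0" for t
  proof -
    have "norm (x t - z) \<le> sqrt (C / (\<alpha> - 3))"
      using C(2)[OF that] assms(6) by (intro real_le_rsqrt) (simp add: field_simps)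
    with norm_triangle_sub[of "x t" z] show ?thesis by linarith
  qed
  have "(x \<longlongrightarrow> z) at_top"
  proof (rule tendstoI)
    fix e :: real assume "e > 0"
    then obtain \<delta> where "\<delta> > 0"
      and \<delta>: "\<And>y. norm y \<le> norm z + sqrt (C / (\<alpha> - 3)) \<Longrightarrow> e \<le> norm (y - z) \<Longrightarrow> \<Phi> z + \<delta> \<le> \<Phi> y"
      using uniformly_convex_argmin_growth[OF diff assms(3) z] by metis
    have "((\<lambda>t. C / t\<^sup>2) \<longlongrightarrow> 0) at_top"
      by (intro tendsto_divide_0[OF tendsto_const] filterlim_at_top_imp_at_infinity
          filterlim_pow_at_top filterlim_ident) simp
    then have "\<forall>\<^sub>F t in at_top. C / t\<^sup>2 < \<delta>"
      using \<open>\<delta> > 0\<close> by (rule order_tendstoD)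
    then show "\<forall>\<^sub>F t in at_top. dist (x t) z < e"
      using eventually_ge_at_top[of t0]
    proof eventually_elim
      case (elim t)
      have "\<Phi> (x t) - \<Phi> z \<le> C / t\<^sup>2"
        using C(1)[OF elim(2)] elim(2) assms(5) by (simp add: field_simps)
      with elim(1) have "\<Phi> (x t) < \<Phi> z + \<delta>" by linarith
      \<comment> \<open>The growth bound is used in contrapositive form: inside the ball, a value
        below \<open>\<Phi> z + \<delta>\<close> forces distance less than \<open>e\<close> from
        \<open>z\<close>.\<close>
      with \<delta>[OF bounded[OF elim(2)]] show ?case by (force simp: dist_norm)
    qed
  qed
  with uniformly_convex_argmin_unique[OF diff assms(3) z] show ?thesis by blast
qed

end
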